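(* Let $r\ge 3$ and $k\ge 3$ be integers and let $G$ be a $\mathcal{G}_k^{(r)}$-free $r$-graph. Let $F\in\mathcal{M}_2$ be the union of the 1-clusters $T_1,\dots,T_m\in\mathcal{M}_1$ contained in it, and write $e_i=|T_i|$ (so $(e_1,\dots,e_m)$ is a composition of $F$). Then $$|P_1(F)|=\sum_{i=1}^m\left(e_i\binom{r}{2}-e_i+1\right)\quad\text{and}\quad |P_{\overline{1}2}(F)|\ge 1-m+\sum_{i=1}^m (e_i-1)(r-2)^2.$$
   Context: An $r$-graph is identified with its edge set; $|H|$ is its number of edges and $V(H)=\bigcup_{e\in H}e$. The family $\mathcal{G}_k^{(r)}$ consists of all $r$-graphs $H$ such that either $|H|=k$ and $|V(H)|\le (r-2)k+2$, or $|H|=\ell$ and $|V(H)|\le (r-2)\ell+1$ for some $\ell\in\{2,\dots,k-1\}$; $G$ is $\mathcal{G}_k^{(r)}$-free if no subset of its edges forms a member of this family. For $F\subseteq G$ and distinct vertices $x,y$, let $C_F(xy)$ be the set of integers $i\ge 0$ for which there exist $i$ distinct edges $e_1,\dots,e_i\in F$ with $|\{x,y\}\cup e_1\cup\dots\cup e_i|\le (r-2)i+2$. Let $P_1(F)$ be the set of pairs $xy\in\binom{V(F)}{2}$ with $1\in C_F(xy)$, and $P_{\overline{1}2}(F)$ the set of pairs $xy\in\binom{V(F)}{2}$ with $2\in C_F(xy)$ and $1\notin C_F(xy)$. An $r$-graph is connected if for any edges $X,Y$ of it there are edges $X=X_1,\dots,X_m=Y$ with $|X_i\cap X_{i+1}|\ge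 2$ for all $i$. $\mathcal{M}_1$ is the partition of $E(G)$ into maximal connected subgraphs (1-clusters). Edge-disjoint $F,H\subseteq G$ are $1|2$-mergeable if there is a pair $xy$ with $1\in C_F(xy)$ and $2\in C_H(xy)$, or $2\in C_F(xy)$ and $1\in C_H(xy)$. $\mathcal{M}_2$ is a partition of $E(G)$ obtained from $\mathcal{M}_1$ by repeatedly replacing two distinct $1|2$-mergeable parts by their union as long as possible; each part of $\mathcal{M}_2$ is a union of elements of $\mathcal{M}_1$. *)

theory Defs
  imports Main
begin

text \<open>An \<open>r\<close>-graph is a finite set of \<open>r\<close>-element edges; its vertex set \<open>V(H)\<close> is \<^term>\<open>\<Union>H\<close>.\<close>

definition r_graph :: "nat \<Rightarrow> 'a set set \<Rightarrow> bool" where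
  "r_graph r H \<longleftrightarrow> finite H \<and> (\<forall>e\<in>H. finite e \<and> card e = r)"

definition forb_family :: "nat \<Rightarrow> nat \<Rightarrow> 'a set set set" where
  "forb_family r k = {H. r_graph r H \<and>
     ((card H = k \<and> card (\<Union>H) \<le> (r - 2) * k + 2) \<or>
      (\<exists>l\<in>{2..k-1}. card H = l \<and> card (\<Union>H) \<le> (r - 2) * l + 1))}"

definition forb_free :: "nat \<Rightarrow> nat \<Rightarrow> 'a set set \<Rightarrow> bool" where
  "forb_free r k G \<longleftrightarrow> (\<forall>H. H \<subseteq> G \<longrightarrow> H \<notin> forb_family r k)"

text \<open>The set \<open>C\<^sub>F(xy)\<close>. The pair \<open>xy\<close> is passed as the two-element set \<open>p = {x, y}\<close>, and
  \<open>S\<close> is the set of the \<open>i\<close> distinct edges.\<close>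

definition claims :: "nat \<Rightarrow> 'a set set \<Rightarrow> 'a set \<Rightarrow> nat set" where
  "claims r F p =
     {i. \<exists>S. S \<subseteq> F \<and> finite S \<and> card S = i \<and> card (p \<union> \<Union>S) \<le> (r - 2) * i + 2}"

definition vertex_pairs :: "'a set set \<Rightarrow> 'a set set" where
  "vertex_pairs F = {p. p \<subseteq> \<Union>F \<and> card p = 2}"

definition P1 :: "nat \<Rightarrow> 'a set set \<Rightarrow> 'a set set" where
  "P1 r F = {p \<in> vertex_pairs F. 1 \<in> claims r F p}"

definition P2_not1 :: "nat \<Rightarrow> 'a set set \<Rightarrow> 'a set set" where
  "P2_not1 r F = {p \<in> vertex_pairs F. 2 \<in> claims r F p \<and> 1 \<notin> claims r F p}"

definition connected_graph :: "'a set set \<Rightarrow> bool" where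
  "connected_graph F \<longleftrightarrow>
     (\<forall>X\<in>F. \<forall>Y\<in>F. \<exists>Xs. Xs \<noteq> [] \<and> set Xs \<subseteq> F \<and> hd Xs = X \<and> last Xs = Y \<and>
        successively (\<lambda>A B. card (A \<inter> B) \<ge> 2) Xs)"

text \<open>The partition \<open>\<M>\<^sub>1\<close> into 1-clusters. The empty graph is vacuously connected, so
  nonemptiness is required explicitly (it only matters when \<open>G\<close> has no edges).\<close>

definition M1 :: "'a set set \<Rightarrow> 'a set set set" where
  "M1 G = {T. T \<subseteq> G \<and> T \<noteq> {} \<and> connected_graph T \<and>
     (\<forall>T'. T \<subseteq> T' \<and> T' \<subseteq> G \<and> connected_graph T' \<longrightarrow> T' = T)}"

definition mergeable12 :: "nat \<Rightarrow> 'a set set \<Rightarrow> 'a set set \<Rightarrow> bool" where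
  "mergeable12 r F H \<longleftrightarrow> F \<inter> H = {} \<and>
     (\<exists>p. card p = 2 \<and>
        ((1 \<in> claims r F p \<and> 2 \<in> claims r H p) \<or> (2 \<in> claims r F p \<and> 1 \<in> claims r H p)))"

definition merge_step :: "nat \<Rightarrow> 'a set set set \<Rightarrow> 'a set set set \<Rightarrow> bool" where
  "merge_step r P Q \<longleftrightarrow>
     (\<exists>F\<in>P. \<exists>H\<in>P. F \<noteq> H \<and> mergeable12 r F H \<and> Q = insert (F \<union> H) (P - {F, H}))"

text \<open>\<open>P\<close> is a possible outcome \<open>\<M>\<^sub>2\<close> of the merging process. Since the order of the merges
  is left open, this is a predicate on partitions rather than a function of \<open>G\<close>.\<close>

definition is_M2 :: "nat \<Rightarrow> 'a set set \<Rightarrow> 'a set set set \<Rightarrow> bool" where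
  "is_M2 r G P \<longleftrightarrow> (merge_step r)\<^sup>*\<^sup>* (M1 G) P \<and> \<not> (\<exists>Q. merge_step r P Q)"

end

theory Submission
  imports Defs
begin

text \<open>
  Call a set \<open>S\<close> of edges good if it spans at most \<open>(r-2)|S| + 2\<close> vertices. Freeness excludes
  good sets of size \<open>k\<close>, and sets of size between \<open>2\<close> and \<open>k-1\<close> that beat the bound. Building a
  1-cluster edge by edge, each new edge \<open>Y\<close> therefore meets the earlier vertices in exactly one
  pair, which lies in an earlier edge \<open>X\<close>; this gives \<open>binom r 2 - 1\<close> new pairs inside \<open>Y\<close>, and
  the \<open>(r-2)\<^sup>2\<close> pairs between \<open>X - Y\<close> and \<open>Y - X\<close> are 2-claimed and also new.

  When two parts \<open>F\<close>, \<open>H\<close> merge through a pair \<open>p\<close>, it suffices that no other pair is 1- or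
  2-claimed by both, so that each of the \<open>m - 1\<close> merges costs at most one pair. Parts may be
  larger than \<open>k\<close>, but a good subset of a part grows to the whole part by steps of one or
  two edges that keep it good, so good subsets of prescribed size, up to an error of one, are
  available; a second common pair would allow the error to be corrected and yields a good set of
  size \<open>k\<close> or a set that is too dense.
\<close>

section \<open>Good sets, growth and claimed pairs\<close>

definition good :: "nat \<Rightarrow> 'a set set \<Rightarrow> bool" where
  "good r S \<longleftrightarrow> card (\<Union>S) \<le> (r - 2) * card S + 2"

text \<open>The bound on new vertices keeps a good \<open>S\<close> good after adding
  \<open>U\<close>. One edge suffices inside a 1-cluster; two at once may be needed to cross a merge
  through a pair that one side only 2-claims.\<close>

definition growable :: "nat \<Rightarrow> 'a set set \<Rightarrow> bool" where
  "growable r F \<longleftrightarrow> (\<forall>S \<subseteq> F. S \<noteq> {} \<and> S \<noteq> F \<longrightarrow>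
     (\<exists>U \<subseteq> F - S. card U \<in> {1, 2} \<and> card (\<Union>U - \<Union>S) \<le> (r - 2) * card U))"

definition separated :: "'a set set \<Rightarrow> 'a set set \<Rightarrow> bool" where
  "separated F H \<longleftrightarrow> (\<forall>X\<in>F. \<forall>Y\<in>H. card (X \<inter> Y) < 2)"

text \<open>Unlike \<open>P2_not1\<close>, this set is monotone in \<open>F\<close>: a pair leaves
  \<open>P2_not1\<close> when a merge makes it 1-claimed, but it stays here. The bound for
  \<open>P2_not1\<close> is recovered at the end by subtracting \<open>P1\<close>.\<close>

definition claimed :: "nat \<Rightarrow> 'a set set \<Rightarrow> 'a set set" where
  "claimed r F = {p \<in> vertex_pairs F. 1 \<in> claims r F p \<or> 2 \<in> claims r F p}"

definition clusters_in :: "'a set set \<Rightarrow> 'a set set \<Rightarrow> 'a set set set" where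
  "clusters_in G F = {C \<in> M1 G. C \<subseteq> F}"

section \<open>Connectivity and 1-clusters\<close>

lemma successively_crossing:
  assumes "successively R Xs" "Xs \<noteq> []" "hd Xs \<in> S" "last Xs \<notin> S"
  shows "\<exists>A\<in>set Xs. \<exists>B\<in>set Xs. A \<in> S \<and> B \<notin> S \<and> R A B"
  using assms
proof (induction Xs rule: induct_list012)
  case (3 x y zs)
  then show ?case by (cases "y \<in> S") auto
qed auto

lemma connected_crossing:
  assumes "connected_graph F" "X \<in> F" "X \<in> S" "Y \<in> F" "Y \<notin> S"
  obtains A B where "A \<in> F" "B \<in> F" "A \<in> S" "B \<notin> S" "card (A \<inter> B) \<ge> 2"
proof -
  obtain Xs where Xs: "Xs \<noteq> []" "set Xs \<subseteq> F" "hd Xs = X" "last Xs = Y"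
      "successively (\<lambda>A B. card (A \<inter> B) \<ge> 2) Xs"
    using assms(1)[unfolded connected_graph_def, rule_format, OF assms(2,4)] by auto
  have "\<exists>A\<in>set Xs. \<exists>B\<in>set Xs. A \<in> S \<and> B \<notin> S \<and> card (A \<inter> B) \<ge> 2"
    using successively_crossing[OF Xs(5,1)] Xs(3,4) assms(3,5) by auto
  with Xs(2) that show thesis by auto
qed

lemma connected_Un:
  assumes F: "connected_graph F" and H: "connected_graph H"
    and XY: "X \<in> F" "Y \<in> H" "card (X \<inter> Y) \<ge> 2"
  shows "connected_graph (F \<union> H)"
proof -
  let ?R = "\<lambda>A B :: 'a set. card (A \<inter> B) \<ge> 2"
  define walk where "walk A B \<longleftrightarrow> (\<exists>Xs. Xs \<noteq> [] \<and> set Xs \<subseteq> F \<union> H \<and> hd Xs = A \<and> last Xs = B \<and>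
      successively ?R Xs)" for A B
  have walk_trans: "walk A D" if "walk A B" "walk C D" "?R B C" for A B C D
  proof -
    from that(1) obtain Xs where Xs: "Xs \<noteq> []" "set Xs \<subseteq> F \<union> H" "hd Xs = A" "last Xs = B"
        "successively ?R Xs"
      unfolding walk_def by auto
    from that(2) obtain Ys where Ys: "Ys \<noteq> []" "set Ys \<subseteq> F \<union> H" "hd Ys = C" "last Ys = D"
        "successively ?R Ys"
      unfolding walk_def by auto
    have "successively ?R (Xs @ Ys)"
      using Xs Ys that(3) by (simp add: successively_append_iff)
    with Xs Ys show ?thesis
      unfolding walk_def by (intro exI[of _ "Xs @ Ys"]) auto
  qed
  have inF: "walk A B" if "A \<in> F" "B \<in> F" for A B
    using F[unfolded connected_graph_def, rule_format, OF that] unfolding walk_def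
    by (auto intro: le_supI1)
  have inH: "walk A B" if "A \<in> H" "B \<in> H" for A B
    using H[unfolded connected_graph_def, rule_format, OF that] unfolding walk_def
    by (auto intro: le_supI2)
  have "?R Y X" using XY(3) by (simp add: Int_commute)
  then have "walk A B" if "A \<in> F \<union> H" "B \<in> F \<union> H" for A B
    using that XY(3) inF[of A B] inH[of A B] XY(1,2)
      walk_trans[OF inF[OF _ XY(1)] inH[OF XY(2)]] walk_trans[OF inH[OF _ XY(2)] inF[OF XY(1)]] by auto
  then show ?thesis
    unfolding connected_graph_def walk_def by simp
qed

text \<open>A walk in \<open>C\<close> from an edge of \<open>F\<close> to one outside
  \<open>F\<close> would contain two consecutive edges, one in \<open>F\<close> and one in
  \<open>H\<close>, with two common vertices.\<close>

lemma connected_subset_separated: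
  assumes "connected_graph C" "separated F H" "C \<subseteq> F \<union> H"
  shows "C \<subseteq> F \<or> C \<subseteq> H"
proof (rule ccontr)
  assume "\<not> ?thesis"
  then obtain X Y where XY: "X \<in> C" "X \<notin> H" "Y \<in> C" "Y \<notin> F" by blast
  then have "X \<in> F" using assms(3) by blast
  with XY obtain A B where AB: "A \<in> C" "B \<in> C" "A \<in> F" "B \<notin> F" "card (A \<inter> B) \<ge> 2"
    using connected_crossing[OF assms(1), of X F Y] by blast
  then have "B \<in> H" using assms(3) by blast
  with AB assms(2) show False
    unfolding separated_def by fastforce
qed

lemma M1_D:
  assumes "C \<in> M1 G"
  shows "C \<subseteq> G" "C \<noteq> {}" "connected_graph C"
    "\<And>D. C \<subseteq> D \<Longrightarrow> D \<subseteq> G \<Longrightarrow> connected_graph D \<Longrightarrow> D = C"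
  using assms unfolding M1_def by auto

text \<open>Edges of \<open>C\<close> and \<open>D\<close> with two common vertices would make
  \<open>C \<union> D\<close> connected, against maximality.\<close>

lemma M1_separated:
  assumes "C \<in> M1 G" "D \<in> M1 G" "C \<noteq> D"
  shows "separated C D"
proof (rule ccontr)
  assume "\<not> ?thesis"
  then obtain X Y where "X \<in> C" "Y \<in> D" "card (X \<inter> Y) \<ge> 2"
    unfolding separated_def by force
  then have "connected_graph (C \<union> D)"
    using connected_Un M1_D(3) assms by blast
  then have "C \<union> D = C" "C \<union> D = D"
    using M1_D(1,4)[OF assms(1)] M1_D(1,4)[OF assms(2)] by auto
  with assms(3) show False by blast
qed

lemma clusters_in_M1:
  assumes "C \<in> M1 G"
  shows "clusters_in G C = {C}"
proof -
  have "D = C" if "D \<in> M1 G" "D \<subseteq> C" for D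
    using M1_D(4)[OF that M1_D(1,3)[OF assms]] by simp
  with assms show ?thesis unfolding clusters_in_def by auto
qed

lemma clusters_in_Un:
  assumes "separated F H"
  shows "clusters_in G (F \<union> H) = clusters_in G F \<union> clusters_in G H"
proof -
  have "C \<subseteq> F \<or> C \<subseteq> H" if "C \<in> M1 G" "C \<subseteq> F \<union> H" for C
    using connected_subset_separated[OF M1_D(3)[OF that(1)] assms that(2)] .
  then show ?thesis
    unfolding clusters_in_def by blast
qed

lemma claims_mono: "F \<subseteq> H \<Longrightarrow> claims r F p \<subseteq> claims r H p"
  unfolding claims_def by blast

lemma vertex_pairs_mono: "F \<subseteq> H \<Longrightarrow> vertex_pairs F \<subseteq> vertex_pairs H"
  unfolding vertex_pairs_def by blast

lemma claimed_mono: "F \<subseteq> H \<Longrightarrow> claimed r F \<subseteq> claimed r H"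
  using claims_mono vertex_pairs_mono unfolding claimed_def by blast

text \<open>Growth of \<open>S \<inter> F\<close> inside \<open>F\<close> also serves
  \<open>S\<close>, since enlarging the old set can only reduce the number of new vertices.\<close>

lemma growable_Un_step:
  assumes "growable r F" "S \<inter> F \<noteq> {}" "\<not> F \<subseteq> S" "finite (\<Union>F)"
  shows "\<exists>U \<subseteq> F - S. card U \<in> {1, 2} \<and> card (\<Union>U - \<Union>S) \<le> (r - 2) * card U"
proof -
  have "S \<inter> F \<subseteq> F" "S \<inter> F \<noteq> F" using assms(3) by auto
  then obtain U where U: "U \<subseteq> F - S \<inter> F" "card U \<in> {1, 2}"
      "card (\<Union>U - \<Union>(S \<inter> F)) \<le> (r - 2) * card U"
    using assms(1,2) unfolding growable_def by metis
  have "card (\<Union>U - \<Union>S) \<le> card (\<Union>U - \<Union>(S \<inter> F))"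
    using U(1) by (intro card_mono finite_subset[OF _ assms(4)]) auto
  with U show ?thesis by (intro exI[of _ U]) auto
qed

section \<open>Vertex counts forced by freeness\<close>

locale sparse_graph =
  fixes r k :: nat and G :: "'a set set"
  assumes r: "r \<ge> 3" and k: "k \<ge> 3" and graph: "r_graph r G" and free: "forb_free r k G"
begin

lemma finite_G: "finite G" and edge: "E \<in> G \<Longrightarrow> finite E \<and> card E = r"
  using graph unfolding r_graph_def by auto

lemma finite_sub: "S \<subseteq> G \<Longrightarrow> finite S" "S \<subseteq> G \<Longrightarrow> finite (\<Union>S)"
  using finite_subset[OF _ finite_G] edge by (auto intro!: finite_Union)

lemma finite_vertex_pairs: "F \<subseteq> G \<Longrightarrow> finite (vertex_pairs F)"
  unfolding vertex_pairs_def by (rule finite_subset[of _ "Pow (\<Union>F)"]) (auto simp: finite_sub)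

lemma not_good_k:
  assumes "S \<subseteq> G" "card S = k"
  shows "\<not> good r S"
proof
  assume "good r S"
  then have "S \<in> forb_family r k"
    using assms graph finite_sub(1)[OF assms(1)]
    unfolding forb_family_def good_def r_graph_def by auto
  then show False using free assms(1) unfolding forb_free_def by blast
qed

text \<open>The converse bound to \<open>good\<close>; good sets with fewer than \<open>k\<close>
  edges therefore attain equality. The forbidden family starts at two edges, so a single edge is
  checked directly.\<close>

lemma vertices_ge:
  assumes "S \<subseteq> G" "1 \<le> card S" "card S < k"
  shows "card (\<Union>S) \<ge> (r - 2) * card S + 2"
proof (cases "card S = 1")
  case True
  then obtain E where "S = {E}" by (auto simp: card_1_singleton_iff)
  then show ?thesis using edge[of E] assms(1) r by simp
next
  case False
  show ?thesis
  proof (rule ccontr)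
    assume "\<not> ?thesis"
    then have "S \<in> forb_family r k"
      using assms False graph finite_sub(1)[OF assms(1)]
      unfolding forb_family_def r_graph_def by auto
    then show False using free assms(1) unfolding forb_free_def by blast
  qed
qed

lemma good_single: "E \<in> G \<Longrightarrow> good r {E}"
  using edge r unfolding good_def by simp

text \<open>Inclusion-exclusion. A common pair keeps the union good; three common vertices push it
  below the bound of \<open>vertices_ge\<close>.\<close>

lemma card_Union_le:
  assumes "good r S" "good r S'" "S \<inter> S' = {}" "S \<subseteq> G" "S' \<subseteq> G" "w \<subseteq> \<Union>S" "w \<subseteq> \<Union>S'"
  shows "card (\<Union>(S \<union> S')) + card w \<le> (r - 2) * card (S \<union> S') + 4"
proof -
  have "card w \<le> card (\<Union>S \<inter> \<Union>S')"
    using assms finite_sub by (intro card_mono) auto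
  moreover have "card (\<Union>S) + card (\<Union>S') = card (\<Union>S \<union> \<Union>S') + card (\<Union>S \<inter> \<Union>S')"
    using assms finite_sub by (intro card_Un_Int) auto
  moreover have "card (S \<union> S') = card S + card S'"
    using assms finite_sub by (intro card_Un_disjoint) auto
  ultimately show ?thesis
    using assms(1,2) unfolding good_def by (simp add: algebra_simps)
qed

lemma good_Un:
  assumes "good r S" "good r S'" "S \<inter> S' = {}" "S \<subseteq> G" "S' \<subseteq> G" "w \<subseteq> \<Union>S" "w \<subseteq> \<Union>S'" "card w = 2"
  shows "good r (S \<union> S')"
  using card_Union_le[OF assms(1-7)] assms(8) unfolding good_def by simp

text \<open>By definition \<open>p\<close> might stick out of the claiming edges. But
  \<open>i\<close> edges, fewer than \<open>k\<close> because \<open>k \<ge> 3\<close>, already span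
  \<open>(r - 2) * i + 2\<close> vertices, so \<open>p\<close> adds none.\<close>

lemma claims_witness:
  assumes "F \<subseteq> G" "i \<in> claims r F p" "i \<in> {1, 2}" "finite p"
  obtains S where "S \<subseteq> F" "card S = i" "good r S" "p \<subseteq> \<Union>S"
proof -
  obtain S where S: "S \<subseteq> F" "card S = i" "card (p \<union> \<Union>S) \<le> (r - 2) * i + 2"
    using assms(2) unfolding claims_def by blast
  have fin: "finite (p \<union> \<Union>S)" using finite_sub S(1) assms(1,4) by auto
  have "card (\<Union>S) \<ge> (r - 2) * i + 2"
    using vertices_ge[of S] S assms(1,3) k by auto
  with S(3) fin have "\<Union>S = p \<union> \<Union>S"
    by (intro card_seteq) auto
  then have "p \<subseteq> \<Union>S" by blast
  moreover from this S have "good r S"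
    unfolding good_def by (simp add: Un_absorb1)
  ultimately show thesis using that S by blast
qed

lemma claims_1_iff:
  assumes "F \<subseteq> G" "finite p"
  shows "1 \<in> claims r F p \<longleftrightarrow> (\<exists>E\<in>F. p \<subseteq> E)"
proof
  assume "1 \<in> claims r F p"
  then obtain S where "S \<subseteq> F" "card S = 1" "p \<subseteq> \<Union>S"
    by (rule claims_witness[OF assms(1) _ _ assms(2)]) auto
  then show "\<exists>E\<in>F. p \<subseteq> E" by (auto simp: card_1_singleton_iff)
next
  assume "\<exists>E\<in>F. p \<subseteq> E"
  then obtain E where "E \<in> F" "p \<subseteq> E" by blast
  then show "1 \<in> claims r F p"
    using edge[of E] assms(1) r unfolding claims_def
    by (auto simp: Un_absorb1 intro!: exI[of _ "{E}"])
qed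

lemma P1_eq:
  assumes "F \<subseteq> G"
  shows "P1 r F = {p. card p = 2 \<and> (\<exists>E\<in>F. p \<subseteq> E)}"
proof -
  have "1 \<in> claims r F p \<longleftrightarrow> (\<exists>E\<in>F. p \<subseteq> E)" if "card p = 2" for p
    using claims_1_iff[OF assms, of p] that card_ge_0_finite[of p] by simp
  then show ?thesis
    unfolding P1_def vertex_pairs_def by blast
qed

lemma claimed_eq: "claimed r F = P1 r F \<union> P2_not1 r F" "P1 r F \<inter> P2_not1 r F = {}"
  unfolding claimed_def P1_def P2_not1_def by auto

lemma finite_claimed: "F \<subseteq> G \<Longrightarrow> finite (claimed r F)"
  using finite_vertex_pairs by (simp add: claimed_def)

lemma card_claimed: "F \<subseteq> G \<Longrightarrow> card (claimed r F) = card (P1 r F) + card (P2_not1 r F)"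
  using finite_claimed claimed_eq by (metis card_Un_disjoint finite_Un)

section \<open>Growing good sets and bounding the overlap of two parts\<close>

lemma connected_growable:
  assumes "connected_graph F" "F \<subseteq> G"
  shows "growable r F"
  unfolding growable_def
proof (intro allI impI)
  fix S assume S: "S \<subseteq> F" "S \<noteq> {} \<and> S \<noteq> F"
  then obtain X Y where "X \<in> F" "X \<in> S" "Y \<in> F" "Y \<notin> S" by blast
  then obtain A B where AB: "A \<in> F" "B \<in> F" "A \<in> S" "B \<notin> S" "card (A \<inter> B) \<ge> 2"
    using connected_crossing[OF assms(1)] by metis
  have B: "finite B" "card B = r" using edge AB assms by auto
  have "card (B - \<Union>S) \<le> card (B - A \<inter> B)"
    using AB B by (intro card_mono) auto
  also have "\<dots> = card B - card (A \<inter> B)"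
    using B by (intro card_Diff_subset) auto
  finally have "card (B - \<Union>S) \<le> r - 2" using B AB by simp
  then show "\<exists>U\<subseteq>F - S. card U \<in> {1, 2} \<and> card (\<Union>U - \<Union>S) \<le> (r - 2) * card U"
    using AB by (intro exI[of _ "{B}"]) auto
qed

text \<open>If \<open>S\<close> meets a part without containing it, growth happens inside that part.
  Otherwise \<open>S\<close> is one of the two parts, and the edges claiming \<open>p\<close> in the
  other part share the two vertices of \<open>p\<close> with \<open>S\<close>.\<close>

lemma growable_Un:
  assumes "growable r F" "growable r H" "F \<subseteq> G" "H \<subseteq> G" "mergeable12 r F H"
  shows "growable r (F \<union> H)"
proof -
  obtain p i j where disj: "F \<inter> H = {}" and p: "card p = 2"
    and ij: "i \<in> {1, 2}" "j \<in> {1, 2}" "i \<in> claims r F p" "j \<in> claims r H p"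
    using assms(5) unfolding mergeable12_def by blast
  have fp: "finite p" using p by (simp add: card_ge_0_finite)
  obtain U where U: "U \<subseteq> F" "card U = i" "good r U" "p \<subseteq> \<Union>U"
    using claims_witness[OF assms(3) ij(3,1) fp] by blast
  obtain W where W: "W \<subseteq> H" "card W = j" "good r W" "p \<subseteq> \<Union>W"
    using claims_witness[OF assms(4) ij(4,2) fp] by blast
  have new: "card (\<Union>Y - \<Union>S) \<le> (r - 2) * card Y"
    if "Y \<subseteq> G" "good r Y" "p \<subseteq> \<Union>Y" "p \<subseteq> \<Union>S" for Y S :: "'a set set"
  proof -
    have "card (\<Union>Y - \<Union>S) \<le> card (\<Union>Y - p)"
      using that finite_sub by (intro card_mono) auto
    also have "\<dots> = card (\<Union>Y) - 2"
      using that fp p by (simp add: card_Diff_subset)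
    finally show ?thesis using that(2) unfolding good_def by simp
  qed
  show ?thesis
    unfolding growable_def
  proof (intro allI impI)
    fix S assume S: "S \<subseteq> F \<union> H" "S \<noteq> {} \<and> S \<noteq> F \<union> H"
    consider "S \<inter> F \<noteq> {}" "\<not> F \<subseteq> S" | "S \<inter> H \<noteq> {}" "\<not> H \<subseteq> S" | "S = F" | "S = H"
      using S by blast
    then show "\<exists>U\<subseteq>F \<union> H - S. card U \<in> {1, 2} \<and> card (\<Union>U - \<Union>S) \<le> (r - 2) * card U"
    proof cases
      case 1
      from growable_Un_step[OF assms(1) this finite_sub(2)[OF assms(3)]] show ?thesis
        by (auto simp del: insert_iff)
    next
      case 2
      from growable_Un_step[OF assms(2) this finite_sub(2)[OF assms(4)]] show ?thesis
        by (auto simp del: insert_iff)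
    next
      case 3
      have "card (\<Union>W - \<Union>S) \<le> (r - 2) * card W"
        using new[of W S] W U 3 assms by blast
      with W ij 3 disj show ?thesis by (intro exI[of _ W]) auto
    next
      case 4
      have "card (\<Union>U - \<Union>S) \<le> (r - 2) * card U"
        using new[of U S] W U 4 assms by blast
      with U ij 4 disj show ?thesis by (intro exI[of _ U]) auto
    qed
  qed
qed

text \<open>A largest good set between \<open>S0\<close> and \<open>F\<close> with at most
  \<open>n\<close> edges works. Size \<open>n\<close> itself may be missed by one, as a step can add
  two edges.\<close>

lemma growable_good_subset:
  assumes "growable r F" "F \<subseteq> G" "S0 \<subseteq> F" "S0 \<noteq> {}" "good r S0" "card S0 \<le> n"
  obtains S where "S0 \<subseteq> S" "S \<subseteq> F" "good r S" "card S \<le> n" "n - 1 \<le> card S \<or> S = F"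
proof -
  define Q where "Q S \<longleftrightarrow> S0 \<subseteq> S \<and> S \<subseteq> F \<and> good r S \<and> card S \<le> n" for S
  have "Q S0" using assms unfolding Q_def by auto
  moreover have "\<forall>S. Q S \<longrightarrow> card S < Suc n" unfolding Q_def by auto
  ultimately obtain S where S: "Q S" and max: "\<And>S'. Q S' \<Longrightarrow> card S' \<le> card S"
    using ex_has_greatest_nat[of Q S0 card "Suc n"] by metis
  have "n - 1 \<le> card S \<or> S = F"
  proof (rule ccontr)
    \<comment> \<open>Now \<open>S\<close> has at most \<open>n - 2\<close> edges, so even a step by
      two edges stays within \<open>n\<close>.\<close>
    assume neg: "\<not> ?thesis"
    have "S \<subseteq> F" "S \<noteq> {}" using S assms(4) unfolding Q_def by auto
    with neg assms(1) obtain U where U: "U \<subseteq> F - S" "card U \<in> {1, 2}"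
        "card (\<Union>U - \<Union>S) \<le> (r - 2) * card U"
      unfolding growable_def by metis
    have fin: "finite S" "finite U"
      using finite_sub(1)[OF assms(2)] \<open>S \<subseteq> F\<close> U(1) finite_subset by (blast, blast)
    have cU: "card (S \<union> U) = card S + card U"
      using fin U by (intro card_Un_disjoint) auto
    have "card (\<Union>(S \<union> U)) = card (\<Union>S \<union> (\<Union>U - \<Union>S))"
      by (simp add: Un_Diff_cancel)
    also have "\<dots> \<le> card (\<Union>S) + card (\<Union>U - \<Union>S)" by (rule card_Un_le)
    finally have "good r (S \<union> U)"
      using U S cU unfolding good_def Q_def by (simp add: algebra_simps)
    then have "Q (S \<union> U)"
      using S U cU neg unfolding Q_def by auto
    from max[OF this] cU U show False by auto
  qed
  with S that show thesis unfolding Q_def by blast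
qed

text \<open>First, \<open>H\<close> has at most \<open>k - 2\<close> edges: a good subset of \<open>H\<close> of size \<open>k - 1\<close> that 2-claims \<open>p\<close>
  could be completed by the edge \<open>A\<close> of \<open>F\<close> through \<open>p\<close>. If both claim \<open>q \<noteq> p\<close>, grow in \<open>F\<close> a good
  set \<open>S\<close> around the edges claiming \<open>q\<close> until \<open>S \<union> H\<close> has \<open>k - 1\<close> edges. If \<open>A \<notin> S\<close>, adding \<open>A\<close>
  gives \<open>k\<close> edges; if \<open>A \<in> S\<close>, then \<open>S\<close> and \<open>H\<close> share three vertices.\<close>

lemma claimed_Int_subset:
  assumes F: "growable r F" "F \<subseteq> G" and H: "growable r H" "H \<subseteq> G" and disj: "F \<inter> H = {}"
    and p: "card p = 2" "1 \<in> claims r F p" "2 \<in> claims r H p"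
  shows "claimed r F \<inter> claimed r H \<subseteq> {p}"
proof -
  have fp: "finite p" using p(1) by (simp add: card_ge_0_finite)
  obtain A where A: "A \<in> F" "p \<subseteq> A"
    using claims_1_iff[OF F(2) fp] p(2) by blast
  have AG: "A \<in> G" "A \<notin> H" using A F disj by auto
  obtain W where W: "W \<subseteq> H" "card W = 2" "good r W" "p \<subseteq> \<Union>W"
    using claims_witness[OF H(2) p(3) _ fp] by blast
  have W_ne: "W \<noteq> {}" using W(2) by auto
  have add_A: "\<not> (good r S \<and> card S = k - 1 \<and> p \<subseteq> \<Union>S \<and> A \<notin> S)" if "S \<subseteq> G" for S
  proof
    assume S: "good r S \<and> card S = k - 1 \<and> p \<subseteq> \<Union>S \<and> A \<notin> S"
    then have "good r (S \<union> {A})"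
      using good_Un[of S "{A}" p] good_single AG A that p(1) by auto
    moreover have "card (S \<union> {A}) = k"
      using S k finite_sub(1)[OF that] by simp
    ultimately show False using not_good_k[of "S \<union> {A}"] that AG by auto
  qed
  obtain S where S: "W \<subseteq> S" "S \<subseteq> H" "good r S" "card S \<le> k" "k - 1 \<le> card S \<or> S = H"
    using growable_good_subset[OF H W(1) W_ne W(3), of k] W(2) k by auto
  have "card S \<noteq> k" using not_good_k S H by blast
  moreover have "card S \<noteq> k - 1"
    using add_A[of S] S W(4) AG H(2) by blast
  \<comment> \<open>Both sizes at which growth could have stopped early are excluded, so it
    exhausted \<open>H\<close>.\<close>
  ultimately have "S = H" and H_le: "card H \<le> k - 2"
    using S by auto
  then have goodH: "good r H" and pH: "p \<subseteq> \<Union>H" and H_ge: "2 \<le> card H"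
    using S(3) W Union_mono[OF W(1)] card_mono[OF finite_sub(1)[OF H(2)] W(1)] by auto
  show ?thesis
  proof
    fix q assume q: "q \<in> claimed r F \<inter> claimed r H"
    have q2: "card q = 2" "finite q" "q \<subseteq> \<Union>H"
      using q unfolding claimed_def vertex_pairs_def by (auto intro: card_ge_0_finite)
    show "q \<in> {p}"
    proof (rule ccontr)
      assume "q \<notin> {p}"
      then have "\<not> q \<subseteq> p"
        using card_subset_eq[OF fp, of q] p(1) q2(1) by auto
      then have "card p < card (p \<union> q)"
        using fp q2(2) by (intro psubset_card_mono) auto
      then have pq: "3 \<le> card (p \<union> q)" using p(1) by simp
      obtain i where "i \<in> {1, 2}" "i \<in> claims r F q"
        using q unfolding claimed_def by blast
      then obtain S0 where S0: "S0 \<subseteq> F" "card S0 \<in> {1, 2}" "good r S0" "q \<subseteq> \<Union>S0"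
        using claims_witness[OF F(2) _ _ q2(2)] by metis
      \<comment> \<open>The room left beside \<open>H\<close>; it is at least 2, enough for the one
        or two edges of \<open>S0\<close>.\<close>
      define n where "n = k - card H"
      have n: "2 \<le> n" "n + card H = k" using H_le k unfolding n_def by auto
      have S0_ne: "S0 \<noteq> {}" "card S0 \<le> n" using S0(2) n by auto
      obtain S where S: "S0 \<subseteq> S" "S \<subseteq> F" "good r S" "card S \<le> n" "n - 1 \<le> card S \<or> S = F"
        using growable_good_subset[OF F S0(1) S0_ne(1) S0(3) S0_ne(2)] by blast
      have SG: "S \<subseteq> G" "S \<inter> H = {}" "q \<subseteq> \<Union>S"
        using S(2) F(2) disj S0(4) Union_mono[OF S(1)] by auto
      have cSH: "card (S \<union> H) = card S + card H"
        using SG H finite_sub by (intro card_Un_disjoint) auto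
      have gSH: "good r (S \<union> H)"
        using good_Un[OF S(3) goodH SG(2,1) H(2) SG(3) q2(3,1)] .
      have "card S \<noteq> n"
        using not_good_k[of "S \<union> H"] gSH cSH n SG H by auto
      then have lt: "card S < n" using S by simp
      show False
      proof (cases "A \<in> S")
        case True
        then have "p \<union> q \<subseteq> \<Union>S" using A SG by blast
        moreover have "p \<union> q \<subseteq> \<Union>H" using pH q2 by blast
        ultimately have "card (\<Union>(S \<union> H)) + card (p \<union> q) \<le> (r - 2) * card (S \<union> H) + 4"
          using card_Union_le[OF S(3) goodH SG(2,1) H(2)] by blast
        moreover have "card (\<Union>(S \<union> H)) \<ge> (r - 2) * card (S \<union> H) + 2"
          using vertices_ge[of "S \<union> H"] SG H cSH n lt H_ge by auto
        ultimately show False using pq by linarith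
      next
        case False
        \<comment> \<open>\<open>A\<close> lies in \<open>F\<close> but not in \<open>S\<close>, so
          growth did not exhaust \<open>F\<close> and stopped at \<open>n - 1\<close> edges.\<close>
        then have "card (S \<union> H) = k - 1" using S(5) A(1) lt cSH n by auto
        then show False
          using add_A[of "S \<union> H"] gSH pH False AG SG H by auto
      qed
    qed
  qed
qed

section \<open>Pair counts for a union of two parts\<close>

lemma card_claimed_Un:
  assumes "growable r F" "F \<subseteq> G" "growable r H" "H \<subseteq> G" "mergeable12 r F H"
  shows "card (claimed r F) + card (claimed r H) \<le> card (claimed r (F \<union> H)) + 1"
proof -
  obtain p where "claimed r F \<inter> claimed r H \<subseteq> {p}"
    using assms(5) claimed_Int_subset[OF assms(1-4)] claimed_Int_subset[OF assms(3,4,1,2)]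
    unfolding mergeable12_def by (metis Int_commute)
  then have "card (claimed r F \<inter> claimed r H) \<le> 1"
    using card_mono[of "{p}"] by auto
  moreover have "card (claimed r F \<union> claimed r H) \<le> card (claimed r (F \<union> H))"
    using finite_claimed[of "F \<union> H"] assms(2,4) claimed_mono[of _ "F \<union> H"]
    by (intro card_mono) auto
  ultimately show ?thesis
    using card_Un_Int[OF finite_claimed[OF assms(2)] finite_claimed[OF assms(4)]] by simp
qed

text \<open>No loss occurs here: a pair 1-claimed by both sides would lie in an edge of each,
  against separation.\<close>

lemma card_P1_Un:
  assumes "separated F H" "F \<subseteq> G" "H \<subseteq> G"
  shows "card (P1 r (F \<union> H)) = card (P1 r F) + card (P1 r H)"
proof -
  have "P1 r (F \<union> H) = P1 r F \<union> P1 r H"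
    using assms by (auto simp: P1_eq)
  moreover have "P1 r F \<inter> P1 r H = {}"
  proof (rule ccontr)
    assume "\<not> ?thesis"
    then obtain p X Y where p: "card p = 2" "X \<in> F" "Y \<in> H" "p \<subseteq> X \<inter> Y"
      using assms by (auto simp: P1_eq)
    then have "card p \<le> card (X \<inter> Y)"
      using edge assms by (intro card_mono) auto
    with p assms(1) show False unfolding separated_def by fastforce
  qed
  moreover have "finite (P1 r F)" "finite (P1 r H)"
    using finite_vertex_pairs assms by (auto simp: P1_def)
  ultimately show ?thesis by (simp add: card_Un_disjoint)
qed

section \<open>Pair counts for one 1-cluster\<close>

text \<open>Freeness makes \<open>Y\<close> meet the old vertices in exactly the pair
  \<open>X \<inter> Y\<close>. This is the one pair inside \<open>Y\<close> that was already
  claimed, which accounts for the \<open>+ 1\<close>. The enlarged set is good, so it cannot have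
  \<open>k\<close> edges and its size stays below \<open>k\<close>.\<close>

lemma add_edge:
  assumes T: "T \<subseteq> G" and S: "S \<subseteq> T" "S \<noteq> {}" "good r S" "card S < k"
    and XY: "X \<in> S" "Y \<in> T" "Y \<notin> S" "card (X \<inter> Y) \<ge> 2"
  shows "good r (insert Y S)" "card (insert Y S) < k"
    "card (P1 r (insert Y S)) + 1 = card (P1 r S) + (r choose 2)"
    "card (claimed r (insert Y S)) + 1 \<ge> card (claimed r S) + (r choose 2) + (r - 2)\<^sup>2"
proof -
  have SG: "S \<subseteq> G" "insert Y S \<subseteq> G" using T S XY by auto
  have fin: "finite S" "finite (\<Union>S)" using finite_sub SG by auto
  have E: "finite X" "card X = r" "finite Y" "card Y = r"
    using edge XY T S by blast+
  obtain w where w: "w \<subseteq> X \<inter> Y" "card w = 2"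
    using XY(4) obtain_subset_with_card_n by metis
  have "good r (S \<union> {Y})"
    using good_Un[OF S(3) good_single, of Y w] SG XY w by auto
  then show gI: "good r (insert Y S)" by simp
  have cI: "card (insert Y S) = card S + 1" using fin XY by simp
  then show lt: "card (insert Y S) < k"
    using not_good_k[OF SG(2)] gI S(4) by linarith
  \<comment> \<open>With three or more old vertices in \<open>Y\<close>, the set
    \<open>insert Y S\<close> would span fewer vertices than \<open>vertices_ge\<close>
    allows.\<close>
  have "card (\<Union>S \<inter> Y) \<le> 2"
  proof -
    have "card (\<Union>(S \<union> {Y})) + card (\<Union>S \<inter> Y) \<le> (r - 2) * card (S \<union> {Y}) + 4"
      using card_Union_le[OF S(3) good_single, of Y "\<Union>S \<inter> Y"] SG XY by auto
    moreover have "(r - 2) * card (insert Y S) + 2 \<le> card (\<Union>(insert Y S))"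
      using vertices_ge[OF SG(2)] lt cI by auto
    ultimately show ?thesis by simp
  qed
  then have "X \<inter> Y = \<Union>S \<inter> Y"
    using XY fin by (intro card_seteq) auto
  then have VY: "\<Union>S \<inter> Y = X \<inter> Y" and cXY: "card (X \<inter> Y) = 2"
    using \<open>card (\<Union>S \<inter> Y) \<le> 2\<close> XY(4) by auto
  define K where "K = {q. q \<subseteq> Y \<and> card q = 2}"
  have K: "finite K" "card K = r choose 2"
    unfolding K_def using E n_subsets[of Y 2] by auto
  have KV: "q = X \<inter> Y" if "q \<in> K" "q \<subseteq> \<Union>S" for q
  proof -
    have "q \<subseteq> X \<inter> Y" using that VY unfolding K_def by blast
    with that cXY E show ?thesis unfolding K_def by (intro card_subset_eq) auto
  qed
  have XYK: "X \<inter> Y \<in> K" "X \<inter> Y \<in> P1 r S"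
    using cXY XY SG by (auto simp: K_def P1_eq)
  have claimedV: "q \<subseteq> \<Union>S" if "q \<in> claimed r S" for q
    using that unfolding claimed_def vertex_pairs_def by blast
  have P1sub: "P1 r S \<subseteq> claimed r S" using claimed_eq by blast
  have fP: "finite (claimed r S)" "finite (P1 r S)"
    using finite_claimed[OF SG(1)] finite_subset[OF P1sub] by auto

  have "P1 r (insert Y S) = P1 r S \<union> K"
    using SG by (auto simp: P1_eq K_def)
  moreover have "P1 r S \<inter> K = {X \<inter> Y}"
    using XYK KV claimedV P1sub by blast
  ultimately show "card (P1 r (insert Y S)) + 1 = card (P1 r S) + (r choose 2)"
    using card_Un_Int[OF fP(2) K(1)] K(2) by simp

  define N where "N = (\<lambda>(x, y). {x, y}) ` ((X - Y) \<times> (Y - X))"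
  have "inj_on (\<lambda>(x, y). {x, y}) ((X - Y) \<times> (Y - X))"
    by (auto simp: inj_on_def doubleton_eq_iff)
  then have "card N = card (X - Y) * card (Y - X)"
    unfolding N_def by (simp add: card_image card_cartesian_product)
  moreover have "card (X - Y) = r - 2" "card (Y - X) = r - 2"
    using E cXY by (auto simp: card_Diff_subset_Int Int_commute)
  ultimately have cN: "card N = (r - 2)\<^sup>2" by (simp add: power2_eq_square)
  have fN: "finite N" unfolding N_def using E by auto
  \<comment> \<open>One end of such a pair lies in \<open>Y - X\<close>, hence outside
    \<open>\<Union>S\<close> by \<open>VY\<close>; the other lies in \<open>X - Y\<close>, hence
    outside \<open>Y\<close>.\<close>
  have NV: "\<not> q \<subseteq> \<Union>S" "q \<notin> K" if "q \<in> N" for q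
    using that VY unfolding N_def K_def by auto
  have "X \<noteq> Y" using XY by blast
  have NC: "N \<subseteq> claimed r (insert Y S)"
  proof
    fix q assume "q \<in> N"
    then obtain x y where q: "q = {x, y}" "x \<in> X - Y" "y \<in> Y - X" unfolding N_def by auto
    then have "q \<subseteq> X \<union> Y" "card q = 2" by (auto simp: card_insert_if)
    moreover have "card (X \<union> Y) = (r - 2) * 2 + 2"
      using card_Un_Int[OF E(1,3)] E cXY r by simp
    moreover have "q \<union> \<Union>{X, Y} = X \<union> Y" using \<open>q \<subseteq> X \<union> Y\<close> by auto
    moreover have "{X, Y} \<subseteq> insert Y S" "card {X, Y} = 2"
      using XY(1) \<open>X \<noteq> Y\<close> by auto
    ultimately have "2 \<in> claims r (insert Y S) q"
      unfolding claims_def by (intro CollectI exI[of _ "{X, Y}"]) simp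
    with q XY show "q \<in> claimed r (insert Y S)"
      using \<open>card q = 2\<close> unfolding claimed_def vertex_pairs_def by auto
  qed
  have "K \<subseteq> claimed r (insert Y S)"
    using \<open>P1 r (insert Y S) = P1 r S \<union> K\<close> claimed_eq by blast
  moreover have "claimed r S \<subseteq> claimed r (insert Y S)" by (rule claimed_mono) auto
  ultimately have "card (claimed r S \<union> K \<union> N) \<le> card (claimed r (insert Y S))"
    using NC finite_claimed[OF SG(2)] by (intro card_mono) auto
  moreover have "(claimed r S \<union> K) \<inter> N = {}"
    using NV claimedV by blast
  then have "card (claimed r S \<union> K \<union> N) = card (claimed r S \<union> K) + card N"
    using fP K fN by (intro card_Un_disjoint) auto
  moreover have "claimed r S \<inter> K = {X \<inter> Y}"
    using XYK KV claimedV P1sub by blast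
  then have "card (claimed r S \<union> K) + 1 = card (claimed r S) + (r choose 2)"
    using card_Un_Int[OF fP(1) K(1)] K(2) by simp
  ultimately show "card (claimed r (insert Y S)) + 1 \<ge> card (claimed r S) + (r choose 2) + (r - 2)\<^sup>2"
    using cN by simp
qed

definition cluster_P1 :: "'a set set \<Rightarrow> int" where
  "cluster_P1 C = int (card C) * int (r choose 2) - int (card C) + 1"

definition cluster_P2 :: "'a set set \<Rightarrow> int" where
  "cluster_P2 C = (int (card C) - 1) * (int r - 2)\<^sup>2"

text \<open>A largest subset of \<open>T\<close> satisfying the counts must be \<open>T\<close>,
  since otherwise \<open>add_edge\<close> enlarges it. The invariant carries
  \<open>card S < k\<close>, so a 1-cluster never reaches \<open>k\<close> edges.\<close>

lemma connected_counts:
  assumes T: "connected_graph T" "T \<subseteq> G" "T \<noteq> {}"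
  shows "int (card (P1 r T)) = cluster_P1 T"
    "int (card (claimed r T)) \<ge> cluster_P1 T + cluster_P2 T"
proof -
  define Q where "Q S \<longleftrightarrow> S \<subseteq> T \<and> S \<noteq> {} \<and> good r S \<and> card S < k \<and>
    int (card (P1 r S)) = cluster_P1 S \<and> int (card (claimed r S)) \<ge> cluster_P1 S + cluster_P2 S" for S
  have finT: "finite T" using finite_sub T by blast
  obtain E where E: "E \<in> T" using T by blast
  have "P1 r {E} = {q. q \<subseteq> E \<and> card q = 2}"
    using P1_eq[of "{E}"] E T by auto
  then have "card (P1 r {E}) = r choose 2"
    using n_subsets[of E 2] edge[of E] E T by auto
  moreover have "card (P1 r {E}) \<le> card (claimed r {E})"
    using claimed_eq finite_claimed E T by (intro card_mono) auto
  ultimately have "Q {E}"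
    using E T k good_single unfolding Q_def cluster_P1_def cluster_P2_def by auto
  moreover have "\<forall>S. Q S \<longrightarrow> card S < k"
    unfolding Q_def by auto
  ultimately obtain S where S: "Q S" and max: "\<And>S'. Q S' \<Longrightarrow> card S' \<le> card S"
    using ex_has_greatest_nat[of Q "{E}" card k] by metis
  have "S = T"
  proof (rule ccontr)
    assume "S \<noteq> T"
    have S': "S \<subseteq> T" "S \<noteq> {}" "good r S" "card S < k" using S unfolding Q_def by auto
    with \<open>S \<noteq> T\<close> obtain X0 Y0 where "X0 \<in> T" "X0 \<in> S" "Y0 \<in> T" "Y0 \<notin> S" by blast
    then obtain X Y where XY: "X \<in> S" "Y \<in> T" "Y \<notin> S" "card (X \<inter> Y) \<ge> 2"
      using connected_crossing[OF T(1)] by metis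
    note add = add_edge[OF T(2) S' XY]
    have c: "card (insert Y S) = card S + 1"
      using XY finT S' finite_subset by fastforce
    have "int (card (P1 r (insert Y S))) = cluster_P1 (insert Y S)"
      using add(3) S c unfolding Q_def cluster_P1_def by (simp add: algebra_simps)
    moreover have "int (card (claimed r (insert Y S))) + 1
        \<ge> int (card (claimed r S)) + int (r choose 2) + (int r - 2)\<^sup>2"
    proof -
      have "int (card (claimed r S) + (r choose 2) + (r - 2)\<^sup>2) \<le> int (card (claimed r (insert Y S)) + 1)"
        using add(4) by (simp only: of_nat_le_iff)
      then show ?thesis using r by (simp add: of_nat_diff)
    qed
    then have "int (card (claimed r (insert Y S)))
        \<ge> cluster_P1 (insert Y S) + cluster_P2 (insert Y S)"
      using S c unfolding Q_def cluster_P1_def cluster_P2_def by (simp add: algebra_simps)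
    ultimately have "Q (insert Y S)"
      using add XY S' unfolding Q_def by auto
    from max[OF this] c show False by simp
  qed
  with S show "int (card (P1 r T)) = cluster_P1 T"
    "int (card (claimed r T)) \<ge> cluster_P1 T + cluster_P2 T"
    unfolding Q_def by auto
qed

section \<open>The invariant of the merging process\<close>

text \<open>The term \<open>1 - int (card (clusters_in G F))\<close> allows for one lost pair at
  each of the merges that joined these clusters.\<close>

definition counted :: "'a set set \<Rightarrow> bool" where
  "counted F \<longleftrightarrow> F \<subseteq> G \<and> growable r F \<and>
     int (card (P1 r F)) = (\<Sum>C\<in>clusters_in G F. cluster_P1 C) \<and>
     int (card (claimed r F)) \<ge> 1 - int (card (clusters_in G F))
       + (\<Sum>C\<in>clusters_in G F. cluster_P1 C + cluster_P2 C)"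

lemma counted_M1: "C \<in> M1 G \<Longrightarrow> counted C"
  using connected_counts[of C] connected_growable[of C]
  unfolding counted_def by (auto simp: clusters_in_M1) (auto simp: M1_def)

lemma finite_M1: "finite (M1 G)"
  using finite_G by (intro finite_subset[of "M1 G" "Pow G"]) (auto simp: M1_def)

text \<open>The constants \<open>1 - a\<close> and \<open>1 - b\<close> of the two parts, less the
  one pair lost in the merge, add up to \<open>1 - (a + b)\<close>.\<close>

lemma counted_Un:
  assumes "counted F" "counted H" "separated F H" "mergeable12 r F H"
  shows "counted (F \<union> H)"
proof -
  have "F \<inter> H = {}" using assms(4) unfolding mergeable12_def by blast
  then have disj: "clusters_in G F \<inter> clusters_in G H = {}"
    using M1_D(2) unfolding clusters_in_def by blast
  have fin: "finite (clusters_in G F)" "finite (clusters_in G H)"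
    using finite_M1 unfolding clusters_in_def by auto
  have "card (claimed r F) + card (claimed r H) \<le> card (claimed r (F \<union> H)) + 1"
    "card (P1 r (F \<union> H)) = card (P1 r F) + card (P1 r H)" "growable r (F \<union> H)"
    using assms card_claimed_Un card_P1_Un growable_Un unfolding counted_def by blast+
  then show ?thesis
    using assms(1,2) fin disj unfolding counted_def clusters_in_Un[OF assms(3)]
    by (simp add: sum.union_disjoint card_Un_disjoint)
qed

lemma separated_sym: "separated F H \<Longrightarrow> separated H F"
  unfolding separated_def by (metis Int_commute)

text \<open>Separation of distinct parts is carried along because \<open>counted_Un\<close> requires
  it; it survives a merge as it is a condition on single edges.\<close>

lemma merging_counted:
  assumes "(merge_step r)\<^sup>*\<^sup>* (M1 G) P"
  shows "(\<forall>F\<in>P. counted F) \<and> (\<forall>F\<in>P. \<forall>H\<in>P. F \<noteq> H \<longrightarrow> separated F H)"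
  using assms
proof (induction rule: rtranclp_induct)
  case base
  then show ?case using counted_M1 M1_separated by blast
next
  case (step P Q)
  then obtain F H where FH: "F \<in> P" "H \<in> P" "F \<noteq> H" "mergeable12 r F H"
      "Q = insert (F \<union> H) (P - {F, H})"
    unfolding merge_step_def by blast
  then have "counted (F \<union> H)" using step counted_Un by blast
  moreover have sep: "separated (F \<union> H) D" if "D \<in> P - {F, H}" for D
    using that step.IH FH(1,2) unfolding separated_def by blast
  ultimately show ?case
    using step.IH separated_sym[OF sep] unfolding FH(5) by auto
qed

end

theorem theorem3p9:
  fixes r k m :: nat
    and G F :: "'a set set"
    and M2 :: "'a set set set"
    and T :: "nat \<Rightarrow> 'a set set"
    and e :: "nat \<Rightarrow> nat"
  assumes "r \<ge> 3" and "k \<ge> 3"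
    and "r_graph r G" and "forb_free r k G"
    and "is_M2 r G M2" and "F \<in> M2"
    and "bij_betw T {1..m} {C \<in> M1 G. C \<subseteq> F}"
    and "F = (\<Union>i\<in>{1..m}. T i)"
    and "\<And>i. i \<in> {1..m} \<Longrightarrow> e i = card (T i)"
  shows "int (card (P1 r F)) =
           (\<Sum>i=1..m. int (e i) * int (r choose 2) - int (e i) + 1) \<and>
         int (card (P2_not1 r F)) \<ge>
           1 - int m + (\<Sum>i=1..m. (int (e i) - 1) * (int r - 2)\<^sup>2)"
proof -
  interpret sparse_graph r k G
    using assms by unfold_locales
  have F: "counted F"
    using merging_counted assms(5,6) unfolding is_M2_def by blast
  have bij: "bij_betw T {1..m} (clusters_in G F)"
    using assms(7) unfolding clusters_in_def .
  have m: "card (clusters_in G F) = m"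
    using bij_betw_same_card[OF bij] by simp
  have P1: "(\<Sum>C\<in>clusters_in G F. cluster_P1 C)
      = (\<Sum>i=1..m. int (e i) * int (r choose 2) - int (e i) + 1)"
    using assms(9) unfolding sum.reindex_bij_betw[OF bij, symmetric]
    by (intro sum.cong) (auto simp: cluster_P1_def)
  have P2: "(\<Sum>C\<in>clusters_in G F. cluster_P2 C) = (\<Sum>i=1..m. (int (e i) - 1) * (int r - 2)\<^sup>2)"
    using assms(9) unfolding sum.reindex_bij_betw[OF bij, symmetric]
    by (intro sum.cong) (auto simp: cluster_P2_def)
  \<comment> \<open>Subtracting the exact count of \<open>P1\<close> from the bound for
    \<open>claimed\<close> cancels the \<open>cluster_P1\<close> sum and leaves the bound for
    \<open>P2_not1\<close>.\<close>
  show ?thesis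
    using F card_claimed[of F] unfolding counted_def m sum.distrib P1 P2 by auto
qed

end
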